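(* Let $\mathcal{M}$ and $\mathcal{N}$ be two-outcome quantum measurements on a finite-dimensional Hilbert space $\mathcal{H}_d$, given by POVMs $\{M_1,M_2\}$ and $\{N_1,N_2\}$ (so $M_j,N_j\ge 0$, $M_1+M_2=I$, $N_1+N_2=I$). Then $\mathcal{M}$ and $\mathcal{N}$ can be perfectly discriminated (in a single use, with ancilla-assisted tests allowed) if and only if there exists a unit vector $|\psi\rangle\in\mathcal{H}_d$ such that, for $j=1$ or for $j=2$, $$\langle\psi|M_j|\psi\rangle=1\quad\text{and}\quad \langle\psi|N_j|\psi\rangle=0 .$$
   Context: An $n$-outcome measurement on the $d$-dimensional complex Hilbert space $\mathcal{H}_d$ is a POVM $\{M_j\}_{j=1}^n$: $M_j\ge 0$, $\sum_j M_j=I$. A (single-shot, general ancilla-assisted) test $\mathcal{T}$ with conclusions $c\in\{\mathcal{M},\mathcal{N},f\}$ ($f$ = inconclusive) is a family of positive semidefinite operators $H^{(c)}_j$ on $\mathcal{H}_d$, $j=1,\dots,n$, such that $\sum_c H^{(c)}_j=\rho$ for every $j$, where $\rho\ge0$, $\mathrm{tr}[\rho]=1$ is the same for all $j$ (the normalization of the test). The probability of conclusion $c$ when the tested measurement has POVM $\{A_j\}$ is $p(c|\mathcal{A},\mathcal{T})=\sum_j \mathrm{tr}[H^{(c)}_jA_j]$. With positive prior probabilities $\eta_{\mathcal M},\eta_{\mathcal N}$ summing to one, the error probability is $p_e=\eta_{\mathcal M}p(\mathcal N|\mathcal M,\mathcal T)+\eta_{\mathcal N}p(\mathcal M|\mathcal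 N,\mathcal T)$ and the failure probability is $p_f=\eta_{\mathcal M}p(f|\mathcal M,\mathcal T)+\eta_{\mathcal N}p(f|\mathcal N,\mathcal T)$. The measurements can be perfectly discriminated if some test has $p_e=p_f=0$. *)

theory Defs
  imports "HOL-Analysis.Analysis"
begin

text \<open>Operators on the \<open>d\<close>-dimensional Hilbert space are complex matrices indexed by a finite
  type \<open>'d\<close> with \<open>CARD('d) = d\<close>. The library inner product on \<open>complex ^ 'd\<close> is real-valued, so the
  sesquilinear one is defined here, antilinear in the first argument. Its norm is the library norm.\<close>

definition braket :: "complex ^ 'd \<Rightarrow> complex ^ 'd \<Rightarrow> complex" where
  "braket \<phi> \<psi> = (\<Sum>i\<in>UNIV. cnj (\<phi> $ i) * \<psi> $ i)"

text \<open>Over the complex numbers, real values of the quadratic form already force the matrix to be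
  Hermitian.\<close>

definition pos_semidef :: "complex ^ 'd ^ 'd \<Rightarrow> bool" where
  "pos_semidef A \<longleftrightarrow> (\<forall>\<psi>. braket \<psi> (A *v \<psi>) \<in> \<real>\<^sub>\<ge>\<^sub>0)"

text \<open>Outcomes are numbered from 1 to \<open>n\<close>; values of the families outside this range are
  irrelevant.\<close>

definition povm :: "nat \<Rightarrow> (nat \<Rightarrow> complex ^ 'd ^ 'd) \<Rightarrow> bool" where
  "povm n A \<longleftrightarrow> (\<forall>j\<in>{1..n}. pos_semidef (A j)) \<and> (\<Sum>j=1..n. A j) = mat 1"

datatype conclusion = Concl_M | Concl_N | Inconclusive

definition is_test ::
    "nat \<Rightarrow> complex ^ 'd ^ 'd \<Rightarrow> (conclusion \<Rightarrow> nat \<Rightarrow> complex ^ 'd ^ 'd) \<Rightarrow> bool" where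
  "is_test n \<rho> H \<longleftrightarrow>
     pos_semidef \<rho> \<and> trace \<rho> = 1 \<and>
     (\<forall>j\<in>{1..n}. \<forall>c. pos_semidef (H c j)) \<and>
     (\<forall>j\<in>{1..n}. (\<Sum>c\<in>{Concl_M, Concl_N, Inconclusive}. H c j) = \<rho>)"

text \<open>The trace of a product of two positive semidefinite matrices is real, so taking the real part
  only changes the type.\<close>

definition concl_prob ::
    "nat \<Rightarrow> (conclusion \<Rightarrow> nat \<Rightarrow> complex ^ 'd ^ 'd) \<Rightarrow> conclusion \<Rightarrow>
     (nat \<Rightarrow> complex ^ 'd ^ 'd) \<Rightarrow> real" where
  "concl_prob n H c A = Re (\<Sum>j=1..n. trace (H c j ** A j))"

definition error_prob ::
    "nat \<Rightarrow> real \<Rightarrow> real \<Rightarrow> (nat \<Rightarrow> complex ^ 'd ^ 'd) \<Rightarrow> (nat \<Rightarrow> complex ^ 'd ^ 'd) \<Rightarrow>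
     (conclusion \<Rightarrow> nat \<Rightarrow> complex ^ 'd ^ 'd) \<Rightarrow> real" where
  "error_prob n \<eta>\<^sub>M \<eta>\<^sub>N M N H =
     \<eta>\<^sub>M * concl_prob n H Concl_N M + \<eta>\<^sub>N * concl_prob n H Concl_M N"

definition failure_prob ::
    "nat \<Rightarrow> real \<Rightarrow> real \<Rightarrow> (nat \<Rightarrow> complex ^ 'd ^ 'd) \<Rightarrow> (nat \<Rightarrow> complex ^ 'd ^ 'd) \<Rightarrow>
     (conclusion \<Rightarrow> nat \<Rightarrow> complex ^ 'd ^ 'd) \<Rightarrow> real" where
  "failure_prob n \<eta>\<^sub>M \<eta>\<^sub>N M N H =
     \<eta>\<^sub>M * concl_prob n H Inconclusive M + \<eta>\<^sub>N * concl_prob n H Inconclusive N"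

definition perfectly_discriminable ::
    "nat \<Rightarrow> real \<Rightarrow> real \<Rightarrow> (nat \<Rightarrow> complex ^ 'd ^ 'd) \<Rightarrow> (nat \<Rightarrow> complex ^ 'd ^ 'd) \<Rightarrow> bool" where
  "perfectly_discriminable n \<eta>\<^sub>M \<eta>\<^sub>N M N \<longleftrightarrow>
     (\<exists>\<rho> H. is_test n \<rho> H \<and>
        error_prob n \<eta>\<^sub>M \<eta>\<^sub>N M N H = 0 \<and> failure_prob n \<eta>\<^sub>M \<eta>\<^sub>N M N H = 0)"

end

theory Submission
  imports Defs
begin

text \<open>Let \<open>A j\<close> be the test operators for conclusion \<open>M\<close> and \<open>B j\<close> the sum of the other two.
  Zero error and failure mean \<open>tr (A j N j) = 0 = tr (B j M j)\<close>, hence \<open>A j N j = 0 = B j M j\<close>, and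
  since the two effects of a measurement sum to the identity, \<open>A 1 A 2 = 0 = B 1 B 2\<close>. Now
  \<open>A 1 + B 1 = A 2 + B 2\<close> says that \<open>A 1 - A 2 = B 2 - B 1\<close> are two orthogonal decompositions of one
  Hermitian matrix, which forces \<open>A 1 = B 2\<close> and \<open>A 2 = B 1\<close>: the trace of the square of
  \<open>A 1 - B 2 = A 2 - B 1\<close> is \<open>- tr (A 1 B 1) - tr (B 2 A 2) \<le> 0\<close>. As \<open>\<rho> = A 1 + A 2\<close> is nonzero, some \<open>A j\<close> is
  nonzero, and any normalised vector in its range works. Conversely, \<open>\<psi>\<close> yields a test with
  \<open>\<rho> = |\<psi>\<rangle>\<langle>\<psi>|\<close> that concludes \<open>M\<close> exactly on outcome \<open>j\<close>.\<close>

section \<open>Distributivity of the matrix product and rules for the sesquilinear form\<close>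

lemma matrix_add_rdistrib:
  fixes A B :: "'a::semiring_1 ^ 'n ^ 'm" and C :: "'a ^ 'p ^ 'n"
  shows "(A + B) ** C = A ** C + B ** C"
  by (simp add: matrix_matrix_mult_def vec_eq_iff distrib_right sum.distrib)

lemma matrix_diff_ldistrib:
  fixes A :: "'a::ring_1 ^ 'n ^ 'm" and B C :: "'a ^ 'p ^ 'n"
  shows "A ** (B - C) = A ** B - A ** C"
  by (simp add: matrix_matrix_mult_def vec_eq_iff right_diff_distrib sum_subtractf)

lemma matrix_diff_rdistrib:
  fixes A B :: "'a::ring_1 ^ 'n ^ 'm" and C :: "'a ^ 'p ^ 'n"
  shows "(A - B) ** C = A ** C - B ** C"
  by (simp add: matrix_matrix_mult_def vec_eq_iff left_diff_distrib sum_subtractf)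

lemma braket_add_left: "braket (x + y) z = braket x z + braket y z"
  by (simp add: braket_def algebra_simps sum.distrib)

lemma braket_add_right: "braket x (y + z) = braket x y + braket x z"
  by (simp add: braket_def algebra_simps sum.distrib)

lemma braket_diff_right: "braket x (y - z) = braket x y - braket x z"
  by (simp add: braket_def algebra_simps sum_subtractf)

lemma braket_scale_left: "braket (c *s x) y = cnj c * braket x y"
  by (simp add: braket_def sum_distrib_left mult_ac)

lemma braket_scale_right: "braket x (c *s y) = c * braket x y"
  by (simp add: braket_def sum_distrib_left mult_ac)

lemma cnj_braket: "cnj (braket x y) = braket y x"
  by (simp add: braket_def mult.commute)

lemma braket_zero_right [simp]: "braket x 0 = 0"
  by (simp add: braket_def)

lemma braket_self: "braket x x = of_real ((norm x)\<^sup>2)"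
proof -
  have "(norm x)\<^sup>2 = (\<Sum>i\<in>UNIV. (cmod (x $ i))\<^sup>2)"
    by (simp add: norm_vec_def L2_set_def sum_nonneg)
  then show ?thesis
    by (simp add: braket_def complex_norm_square mult.commute del: of_real_power)
qed

lemma braket_axis_left: "braket (axis i 1) x = x $ i"
proof -
  have "braket (axis i 1) x = (\<Sum>k\<in>UNIV. if k = i then x $ k else 0)"
    unfolding braket_def by (rule sum.cong) (auto simp: axis_def)
  then show ?thesis by simp
qed

lemma matrix_vector_mult_axis_nth:
  fixes A :: "complex ^ 'd ^ 'd"
  shows "(A *v axis i 1) $ k = A $ k $ i"
  by (simp add: matrix_vector_mult_def axis_def if_distrib cong: if_cong)

section \<open>Positive semidefinite matrices: symmetry and kernel\<close>

lemma pos_semidef_form: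
  assumes "pos_semidef A"
  shows "Re (braket x (A *v x)) \<ge> 0" "Im (braket x (A *v x)) = 0"
  using assms by (auto simp: pos_semidef_def complex_nonneg_Reals_iff)

text \<open>Polarisation: the form is real at \<open>x + y\<close> and at
  \<open>x + \<i> *s y\<close>. The first gives the imaginary part of the identity, the second its
  real part.\<close>

lemma pos_semidef_sym:
  assumes "pos_semidef A"
  shows "cnj (braket x (A *v y)) = braket y (A *v x)"
proof -
  have "Im (braket (x + c *s y) (A *v (x + c *s y))) = 0" for c
    using pos_semidef_form(2)[OF assms] .
  from this[of 1] this[of \<i>] show ?thesis
    using pos_semidef_form(2)[OF assms, of x] pos_semidef_form(2)[OF assms, of y]
    by (simp add: complex_eq_iff matrix_vector_right_distrib vector_scalar_commute
        braket_add_left braket_add_right braket_scale_left braket_scale_right)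
qed

lemma pos_semidef_hermitian:
  assumes "pos_semidef A"
  shows "cnj (A $ i $ j) = A $ j $ i"
  using pos_semidef_sym[OF assms, of "axis i 1" "axis j 1"]
  by (simp add: braket_axis_left matrix_vector_mult_axis_nth)

lemma pos_semidef_add: "pos_semidef A \<Longrightarrow> pos_semidef B \<Longrightarrow> pos_semidef (A + B)"
  by (simp add: pos_semidef_def matrix_vector_mult_add_rdistrib braket_add_right)

lemma pos_semidef_zero: "pos_semidef 0"
  by (simp add: pos_semidef_def)

text \<open>Moving from \<open>x\<close> in the direction \<open>A *v x\<close> by a real
  \<open>t\<close> changes the form by a linear term \<open>2 * t * n\<close> and a quadratic one.
  For small negative \<open>t\<close> the linear term would make the form negative.\<close>

lemma pos_semidef_kernel:
  fixes A :: "complex ^ 'd ^ 'd"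
  assumes A: "pos_semidef A" and 0: "braket x (A *v x) = 0"
  shows "A *v x = 0"
proof (rule ccontr)
  assume "A *v x \<noteq> 0"
  define y where "y = A *v x"
  define n where "n = (norm y)\<^sup>2"
  define q where "q = Re (braket y (A *v y))"
  have n: "n > 0" using \<open>A *v x \<noteq> 0\<close> by (simp add: n_def y_def)
  have q: "q \<ge> 0" unfolding q_def by (rule pos_semidef_form(1)[OF A])
  have yx: "braket y (A *v x) = of_real n"
    by (simp only: n_def braket_self flip: y_def)
  have xy: "braket x (A *v y) = of_real n"
    using pos_semidef_sym[OF A, of y x] yx by simp
  have nonneg: "0 \<le> 2 * t * n + t\<^sup>2 * q" for t
    using pos_semidef_form(1)[OF A, of "x + of_real t *s y"] 0 xy yx pos_semidef_form(2)[OF A, of y]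
    by (simp add: matrix_vector_right_distrib vector_scalar_commute q_def power2_eq_square
        braket_add_left braket_add_right braket_scale_left braket_scale_right algebra_simps)
  \<comment> \<open>The minimiser would be at \<open>n / q\<close>; the added 1 covers
    \<open>q = 0\<close> and still leaves \<open>r * q < 2 * n\<close>.\<close>
  define r where "r = n / (q + 1)"
  have "0 \<le> r * (r * q - 2 * n)"
    using nonneg[of "- r"] by (simp add: power2_eq_square algebra_simps)
  moreover have "r > 0" and "r * q = n - r"
    using n q by (simp_all add: r_def field_simps)
  ultimately show False
    using n by (simp add: zero_le_mult_iff)
qed

section \<open>Decomposition into rank-one matrices\<close>

text \<open>The operator |v><v| with \<open>v\<close> unnormalised, so that a decomposition needs no
  separate weights.\<close>

definition outer :: "complex ^ 'd \<Rightarrow> complex ^ 'd ^ 'd" where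
  "outer v = (\<chi> i j. v $ i * cnj (v $ j))"

lemma outer_mult_vec: "outer v *v x = braket v x *s v"
  by (simp add: outer_def matrix_vector_mult_def vec_eq_iff braket_def
      sum_distrib_left sum_distrib_right mult_ac)

lemma pos_semidef_outer: "pos_semidef (outer v)"
  unfolding pos_semidef_def
proof
  fix x
  have "braket x (outer v *v x) = of_real ((cmod (braket x v))\<^sup>2)"
    by (simp add: outer_mult_vec braket_scale_right complex_norm_square cnj_braket mult.commute
        del: of_real_power)
  then show "braket x (outer v *v x) \<in> \<real>\<^sub>\<ge>\<^sub>0"
    by (simp add: complex_nonneg_Reals_iff del: of_real_power)
qed

lemma trace_outer_mult: "trace (outer v ** B) = braket v (B *v v)"
proof -
  have "trace (outer v ** B) = (\<Sum>i\<in>UNIV. \<Sum>k\<in>UNIV. v $ i * cnj (v $ k) * B $ k $ i)"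
    by (simp add: trace_def matrix_matrix_mult_def outer_def)
  also have "\<dots> = (\<Sum>k\<in>UNIV. \<Sum>i\<in>UNIV. v $ i * cnj (v $ k) * B $ k $ i)"
    by (rule sum.swap)
  also have "\<dots> = braket v (B *v v)"
    by (simp add: braket_def matrix_vector_mult_def sum_distrib_left mult_ac)
  finally show ?thesis .
qed

lemma trace_outer: "trace (outer v) = of_real ((norm v)\<^sup>2)"
  using trace_outer_mult[of v "mat 1"] by (simp add: braket_self)

lemma mult_outer_eq_0: "B *v v = 0 \<Longrightarrow> B ** outer v = 0"
  by (simp add: vec_eq_iff matrix_matrix_mult_def outer_def matrix_vector_mult_def
      flip: mult.assoc sum_distrib_right)

text \<open>One step of the Cholesky decomposition, with pivot \<open>i\<close>: \<open>v\<close> is the \<open>i\<close>-th column of \<open>A\<close> divided by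
  \<open>sqrt (A $ i $ i)\<close>. Zero diagonal entries survive, so the number of nonzero ones decreases.\<close>

lemma pos_semidef_schur:
  fixes A :: "complex ^ 'd ^ 'd"
  assumes A: "pos_semidef A" and nz: "A $ i $ i \<noteq> 0"
  obtains v where "pos_semidef (A - outer v)"
    "\<And>k. A $ k $ k = 0 \<Longrightarrow> (A - outer v) $ k $ k = 0" "(A - outer v) $ i $ i = 0"
proof -
  define e where "e = (axis i 1 :: complex ^ 'd)"
  define a where "a = Re (A $ i $ i)"
  have ee: "braket e (A *v e) = A $ i $ i"
    by (simp add: e_def braket_axis_left matrix_vector_mult_axis_nth)
  have aA: "A $ i $ i = of_real a" and "a \<ge> 0"
    using pos_semidef_form[OF A, of e] unfolding ee by (simp_all add: a_def complex_eq_iff)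
  with nz have a: "a > 0" by (cases "a = 0") auto
  define v where "v = of_real (1 / sqrt a) *s (A *v e)"
  have vn: "v $ k = A $ k $ i / of_real (sqrt a)" for k
    by (simp add: v_def e_def matrix_vector_mult_axis_nth)
  have vx: "braket v x = braket e (A *v x) / of_real (sqrt a)" for x
  proof -
    have "cnj (braket v x) = cnj (braket e (A *v x)) / of_real (sqrt a)"
      using pos_semidef_sym[OF A, of e x]
      by (simp add: v_def cnj_braket braket_scale_right)
    then show ?thesis by (metis complex_cnj_cnj complex_cnj_complex_of_real complex_cnj_divide)
  qed
  have sq: "complex_of_real (sqrt a) * complex_of_real (sqrt a) = of_real a"
    using a by (simp flip: of_real_mult)
  show thesis
  proof
    show "pos_semidef (A - outer v)"
      unfolding pos_semidef_def
    proof
      fix x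
      \<comment> \<open>Completing the square: subtracting \<open>c *s e\<close> from
        \<open>x\<close> lowers the form of \<open>A\<close> by exactly the form of
        \<open>outer v\<close>.\<close>
      define c where "c = braket e (A *v x) / of_real a"
      have ex: "braket e (A *v x) = c * of_real a" using a by (simp add: c_def)
      have xe: "braket x (A *v e) = cnj c * of_real a"
        using pos_semidef_sym[OF A, of e x] ex by simp
      have "braket v x * braket x v = cnj c * c * of_real a"
      proof -
        have "braket v x * braket x v = braket v x * cnj (braket v x)" by (simp add: cnj_braket)
        also have "\<dots> = (c * of_real a) * (cnj c * of_real a) / (of_real (sqrt a) * of_real (sqrt a))"
          by (simp add: vx ex)
        also have "\<dots> = cnj c * c * of_real a" unfolding sq using a by simp
        finally show ?thesis .
      qed
      then have "braket x ((A - outer v) *v x) =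
          braket (x + (- c) *s e) (A *v (x + (- c) *s e))"
        unfolding matrix_vector_mult_diff_rdistrib braket_diff_right outer_mult_vec
          matrix_vector_right_distrib vector_scalar_commute braket_add_left braket_add_right
          braket_scale_left braket_scale_right ex xe ee aA
        by (simp add: algebra_simps)
      then show "braket x ((A - outer v) *v x) \<in> \<real>\<^sub>\<ge>\<^sub>0"
        using A by (simp add: pos_semidef_def)
    qed
    show "(A - outer v) $ k $ k = 0" if "A $ k $ k = 0" for k
    proof -
      \<comment> \<open>A zero diagonal entry forces its whole column, and by symmetry its row, to
        vanish; hence \<open>v $ k = 0\<close>.\<close>
      have "A *v axis k 1 = 0"
        by (rule pos_semidef_kernel[OF A])
          (simp add: braket_axis_left matrix_vector_mult_axis_nth that)
      then have "A $ i $ k = 0" by (metis matrix_vector_mult_axis_nth zero_index)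
      then have "A $ k $ i = 0" using pos_semidef_hermitian[OF A, of i k] by simp
      then show ?thesis using that by (simp add: outer_def vn)
    qed
    show "(A - outer v) $ i $ i = 0"
      using a by (simp add: outer_def vn aA sq)
  qed
qed

text \<open>Each Cholesky step clears one more diagonal entry, and once the diagonal is zero every
  basis vector lies in the kernel. This reduces traces of products to single vectors.\<close>

lemma pos_semidef_decomp:
  fixes A :: "complex ^ 'd ^ 'd"
  assumes "pos_semidef A"
  shows "\<exists>vs. A = (\<Sum>v\<leftarrow>vs. outer v)"
  using assms
proof (induction "card {k. A $ k $ k \<noteq> 0}" arbitrary: A rule: less_induct)
  case less
  show ?case
  proof (cases "\<exists>i. A $ i $ i \<noteq> 0")
    case True
    then obtain i where i: "A $ i $ i \<noteq> 0" ..
    obtain v where v: "pos_semidef (A - outer v)"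
      "\<And>k. A $ k $ k = 0 \<Longrightarrow> (A - outer v) $ k $ k = 0" "(A - outer v) $ i $ i = 0"
      using pos_semidef_schur[OF less.prems i] by blast
    have "{k. (A - outer v) $ k $ k \<noteq> 0} \<subset> {k. A $ k $ k \<noteq> 0}"
      using v(2,3) i by blast
    then have "card {k. (A - outer v) $ k $ k \<noteq> 0} < card {k. A $ k $ k \<noteq> 0}"
      by (intro psubset_card_mono) auto
    from less.hyps[OF this v(1)] obtain vs where "A - outer v = (\<Sum>v\<leftarrow>vs. outer v)" ..
    then have "A = (\<Sum>v\<leftarrow>v # vs. outer v)" by (simp add: algebra_simps)
    then show ?thesis ..
  next
    case False
    have "A *v axis i 1 = 0" for i
      by (rule pos_semidef_kernel[OF less.prems])
        (use False in \<open>simp add: braket_axis_left matrix_vector_mult_axis_nth\<close>)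
    then have "A $ k $ i = 0" for k i
      by (metis matrix_vector_mult_axis_nth zero_index)
    then have "A = (\<Sum>v\<leftarrow>[]. outer v)" by (simp add: vec_eq_iff)
    then show ?thesis ..
  qed
qed

section \<open>Trace inequalities and orthogonality\<close>

text \<open>Splitting \<open>A\<close> into terms \<open>outer v\<close> makes the trace a sum of
  nonnegative values of the form of \<open>B\<close>. If the sum is zero, so is each value, and then
  \<open>B\<close> kills every \<open>v\<close>; hence \<open>B\<close> stands on the left.\<close>

lemma pos_semidef_trace_mult:
  fixes A B :: "complex ^ 'd ^ 'd"
  assumes "pos_semidef A" "pos_semidef B"
  shows "Re (trace (A ** B)) \<ge> 0" "Re (trace (A ** B)) = 0 \<Longrightarrow> B ** A = 0"
proof -
  have B: "Re (trace (outer v ** B)) \<ge> 0"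
    "Re (trace (outer v ** B)) = 0 \<Longrightarrow> B ** outer v = 0" for v
    using pos_semidef_form[OF assms(2), of v] pos_semidef_kernel[OF assms(2), of v]
    by (auto simp: trace_outer_mult complex_eq_iff intro: mult_outer_eq_0)
  obtain vs where A: "A = (\<Sum>v\<leftarrow>vs. outer v)" using pos_semidef_decomp[OF assms(1)] ..
  have "Re (trace (A ** B)) \<ge> 0 \<and> (Re (trace (A ** B)) = 0 \<longrightarrow> B ** A = 0)"
    unfolding A
  proof (induction vs)
    case Nil
    then show ?case by (simp add: trace_def matrix_matrix_mult_def vec_eq_iff)
  next
    case (Cons v vs)
    then show ?case using B[of v]
      by (auto simp: matrix_add_rdistrib matrix_add_ldistrib trace_add add_nonneg_eq_0_iff)
  qed
  then show "Re (trace (A ** B)) \<ge> 0" "Re (trace (A ** B)) = 0 \<Longrightarrow> B ** A = 0" by blast+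
qed

text \<open>The trace is the squared Frobenius norm of \<open>D\<close>.\<close>

lemma hermitian_trace_square:
  fixes D :: "complex ^ 'd ^ 'd"
  assumes "\<And>i j. cnj (D $ i $ j) = D $ j $ i" and "Re (trace (D ** D)) \<le> 0"
  shows "D = 0"
proof -
  have "trace (D ** D) = (\<Sum>i\<in>UNIV. \<Sum>j\<in>UNIV. D $ i $ j * cnj (D $ i $ j))"
    by (simp add: trace_def matrix_matrix_mult_def assms(1))
  also have "\<dots> = of_real (\<Sum>i\<in>UNIV. \<Sum>j\<in>UNIV. (cmod (D $ i $ j))\<^sup>2)"
    by (simp add: complex_norm_square del: of_real_power)
  finally have "(\<Sum>i\<in>UNIV. \<Sum>j\<in>UNIV. (cmod (D $ i $ j))\<^sup>2) \<le> 0"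
    using assms(2) by simp
  then have "(\<Sum>i\<in>UNIV. \<Sum>j\<in>UNIV. (cmod (D $ i $ j))\<^sup>2) = 0"
    by (intro antisym sum_nonneg) auto
  then show ?thesis
    by (simp add: sum_nonneg_eq_0_iff sum_nonneg vec_eq_iff)
qed

text \<open>Uniqueness of the positive and negative parts of a Hermitian matrix.\<close>

lemma orthogonal_decomp_unique:
  fixes A1 A2 B1 B2 :: "complex ^ 'd ^ 'd"
  assumes psd: "pos_semidef A1" "pos_semidef A2" "pos_semidef B1" "pos_semidef B2"
    and orth: "A1 ** A2 = 0" "B2 ** B1 = 0" and eq: "A1 + B1 = A2 + B2"
  shows "A1 = B2" "A2 = B1"
proof -
  define D where "D = A1 - B2"
  have D: "D = A2 - B1" using eq by (simp add: D_def algebra_simps)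
  \<comment> \<open>With the two factors written differently, the terms of positive sign are the
    orthogonal products and drop out.\<close>
  have "D ** D = (A1 - B2) ** (A2 - B1)" using D D_def by metis
  also have "\<dots> = - (A1 ** B1) - B2 ** A2"
    by (simp add: matrix_diff_ldistrib matrix_diff_rdistrib orth)
  finally have "trace (D ** D) = - trace (A1 ** B1) - trace (B2 ** A2)"
    by (simp add: trace_def sum_negf sum_subtractf)
  then have "Re (trace (D ** D)) \<le> 0"
    using pos_semidef_trace_mult(1)[OF psd(1,3)] pos_semidef_trace_mult(1)[OF psd(4,2)] by simp
  moreover have "cnj (D $ i $ j) = D $ j $ i" for i j
    by (simp add: D_def pos_semidef_hermitian psd)
  ultimately have "D = 0" by (intro hermitian_trace_square)
  then show "A1 = B2" "A2 = B1" using D by (auto simp: D_def)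
qed

text \<open>Insert \<open>E1 + E2\<close> between the factors: \<open>A1\<close> annihilates
  \<open>E1\<close> from the left, and \<open>E2\<close> annihilates \<open>A2\<close>.\<close>

lemma orthogonal_of_resolution:
  fixes A1 A2 E1 E2 :: "complex ^ 'd ^ 'd"
  assumes "pos_semidef A1" "pos_semidef A2" "pos_semidef E1" "pos_semidef E2"
    and "E1 + E2 = mat 1" "Re (trace (A1 ** E1)) = 0" "Re (trace (A2 ** E2)) = 0"
  shows "A1 ** A2 = 0"
proof -
  have AE: "A1 ** E1 = 0"
    using pos_semidef_trace_mult(2)[OF assms(3,1)] assms(6) trace_mul_sym[of A1 E1] by simp
  have EA: "E2 ** A2 = 0" using pos_semidef_trace_mult(2)[OF assms(2,4)] assms(7) .
  have "A1 ** A2 = A1 ** (E1 + E2) ** A2" by (simp add: assms(5))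
  also have "\<dots> = (A1 ** E1) ** A2 + A1 ** (E2 ** A2)"
    by (simp only: matrix_add_ldistrib matrix_add_rdistrib matrix_mul_assoc)
  finally show ?thesis by (simp add: AE EA)
qed

text \<open>On the range of \<open>A\<close> both \<open>E'\<close> and \<open>F\<close> vanish, so
  \<open>E\<close> acts there as the identity.\<close>

lemma unit_vector_of_annihilated:
  fixes A E E' F :: "complex ^ 'd ^ 'd"
  assumes "A \<noteq> 0" "E + E' = mat 1" "E' ** A = 0" "F ** A = 0"
  obtains \<psi> where "norm \<psi> = 1" "braket \<psi> (E *v \<psi>) = 1" "braket \<psi> (F *v \<psi>) = 0"
proof -
  obtain x where x: "A *v x \<noteq> 0"
    using assms(1) by (metis matrix_vector_mult_axis_nth vec_eq_iff zero_index)
  define \<psi> where "\<psi> = of_real (1 / norm (A *v x)) *s (A *v x)"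
  have 0: "C *v \<psi> = 0" if "C ** A = 0" for C
    using that by (simp add: \<psi>_def vector_scalar_commute matrix_vector_mul_assoc)
  have 1: "braket \<psi> \<psi> = 1"
    using x unfolding \<psi>_def braket_scale_left braket_scale_right
    by (simp add: braket_self power2_eq_square)
  then have "norm \<psi> = 1"
    by (metis braket_self norm_ge_zero of_real_eq_1_iff power2_eq_1_iff abs_of_nonneg abs_minus abs_one)
  moreover have "E *v \<psi> = \<psi>"
    using arg_cong[OF assms(2), of "\<lambda>C. C *v \<psi>"] 0[OF assms(3)]
    by (simp add: matrix_vector_mult_add_rdistrib)
  ultimately show thesis using that 1 0[OF assms(4)] by simp
qed

section \<open>Tests of two-outcome measurements\<close>

lemma povm_two: "povm 2 A \<longleftrightarrow> pos_semidef (A 1) \<and> pos_semidef (A 2) \<and> A 1 + A 2 = mat 1"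
  by (auto simp: povm_def numeral_2_eq_2 atLeastAtMostSuc_conv add.commute)

lemma is_test_two: "is_test 2 \<rho> H \<longleftrightarrow> pos_semidef \<rho> \<and> trace \<rho> = 1 \<and>
    (\<forall>c. pos_semidef (H c 1) \<and> pos_semidef (H c 2)) \<and>
    (\<forall>j\<in>{1,2}. H Concl_M j + (H Concl_N j + H Inconclusive j) = \<rho>)"
  by (auto simp: is_test_def numeral_2_eq_2 atLeastAtMostSuc_conv)

lemma concl_prob_two:
  "concl_prob 2 H c A = Re (trace (H c 1 ** A 1)) + Re (trace (H c 2 ** A 2))"
  by (simp add: concl_prob_def numeral_2_eq_2)

lemma concl_prob_two_nonneg:
  assumes "is_test 2 \<rho> H" "povm 2 A"
  shows "concl_prob 2 H c A \<ge> 0"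
  using assms by (simp add: concl_prob_two is_test_two povm_two pos_semidef_trace_mult(1))

lemma concl_prob_two_eq_0:
  assumes "is_test 2 \<rho> H" "povm 2 A" "concl_prob 2 H c A = 0"
  shows "Re (trace (H c 1 ** A 1)) = 0" "Re (trace (H c 2 ** A 2)) = 0"
  using assms
  by (simp_all add: concl_prob_two is_test_two povm_two pos_semidef_trace_mult(1) add_nonneg_eq_0_iff)

text \<open>Both priors are positive and all probabilities nonnegative, so a weighted sum vanishes
  only termwise.\<close>

lemma perfectly_discriminable_iff:
  assumes "povm 2 M" "povm 2 N" "\<eta>\<^sub>M > 0" "\<eta>\<^sub>N > 0"
  shows "perfectly_discriminable 2 \<eta>\<^sub>M \<eta>\<^sub>N M N \<longleftrightarrow>
    (\<exists>\<rho> H. is_test 2 \<rho> H \<and> concl_prob 2 H Concl_N M = 0 \<and> concl_prob 2 H Concl_M N = 0 \<and>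
      concl_prob 2 H Inconclusive M = 0 \<and> concl_prob 2 H Inconclusive N = 0)"
proof -
  have "error_prob 2 \<eta>\<^sub>M \<eta>\<^sub>N M N H = 0 \<longleftrightarrow> concl_prob 2 H Concl_N M = 0 \<and> concl_prob 2 H Concl_M N = 0"
    "failure_prob 2 \<eta>\<^sub>M \<eta>\<^sub>N M N H = 0 \<longleftrightarrow>
      concl_prob 2 H Inconclusive M = 0 \<and> concl_prob 2 H Inconclusive N = 0"
    if "is_test 2 \<rho> H" for \<rho> H
    using assms(3,4) concl_prob_two_nonneg[OF that assms(1)] concl_prob_two_nonneg[OF that assms(2)]
    by (simp_all add: error_prob_def failure_prob_def add_nonneg_eq_0_iff)
  then show ?thesis
    unfolding perfectly_discriminable_def by metis
qed

theorem theorem1: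
  fixes M N :: "nat \<Rightarrow> complex ^ 'd::finite ^ 'd"
    and \<eta>\<^sub>M \<eta>\<^sub>N :: real
  assumes "povm 2 M" and "povm 2 N"
    and "\<eta>\<^sub>M > 0" and "\<eta>\<^sub>N > 0" and "\<eta>\<^sub>M + \<eta>\<^sub>N = 1"
  shows "perfectly_discriminable 2 \<eta>\<^sub>M \<eta>\<^sub>N M N \<longleftrightarrow>
    (\<exists>\<psi> :: complex ^ 'd. norm \<psi> = 1 \<and>
       (\<exists>j\<in>{1, 2}. braket \<psi> (M j *v \<psi>) = 1 \<and> braket \<psi> (N j *v \<psi>) = 0))"
  (is "?L \<longleftrightarrow> ?R")
proof
  assume ?L
  then obtain \<rho> H where H: "is_test 2 \<rho> H"
    and p: "concl_prob 2 H Concl_N M = 0" "concl_prob 2 H Concl_M N = 0"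
      "concl_prob 2 H Inconclusive M = 0"
    unfolding perfectly_discriminable_iff[OF assms(1-4)] by blast
  define A B where "A = H Concl_M" and "B = (\<lambda>j. H Concl_N j + H Inconclusive j)"
  have psd: "pos_semidef (A 1)" "pos_semidef (A 2)" "pos_semidef (B 1)" "pos_semidef (B 2)"
    using H by (auto simp: is_test_two A_def B_def intro: pos_semidef_add)
  have sum: "A 1 + B 1 = \<rho>" "A 2 + B 2 = \<rho>" and tr: "trace \<rho> = 1"
    using H by (auto simp: is_test_two A_def B_def)
  have M: "pos_semidef (M 1)" "pos_semidef (M 2)" "M 1 + M 2 = mat 1" "M 2 + M 1 = mat 1"
    and N: "pos_semidef (N 1)" "pos_semidef (N 2)" "N 1 + N 2 = mat 1"
    using assms(1,2) by (auto simp: povm_two add.commute)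
  have AN: "Re (trace (A 1 ** N 1)) = 0" "Re (trace (A 2 ** N 2)) = 0"
    using concl_prob_two_eq_0[OF H assms(2) p(2)] by (auto simp: A_def)
  have BM: "Re (trace (B 1 ** M 1)) = 0" "Re (trace (B 2 ** M 2)) = 0"
    using concl_prob_two_eq_0[OF H assms(1) p(1)] concl_prob_two_eq_0[OF H assms(1) p(3)]
    by (auto simp: B_def matrix_add_rdistrib trace_add)
  have "A 1 ** A 2 = 0" by (rule orthogonal_of_resolution[OF psd(1,2) N AN])
  moreover have "B 2 ** B 1 = 0"
    by (rule orthogonal_of_resolution[OF psd(4,3) M(2,1,4) BM(2,1)])
  ultimately have AB: "A 1 = B 2" "A 2 = B 1"
    using orthogonal_decomp_unique[OF psd] sum by auto
  \<comment> \<open>The last two come from \<open>BM\<close>, which speaks of \<open>A\<close> after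
    replacing \<open>B 2\<close> by \<open>A 1\<close> and \<open>B 1\<close> by
    \<open>A 2\<close>.\<close>
  have ann: "N 1 ** A 1 = 0" "N 2 ** A 2 = 0" "M 2 ** A 1 = 0" "M 1 ** A 2 = 0"
    using pos_semidef_trace_mult(2) psd M N AN BM AB by metis+
  have "A 1 \<noteq> 0 \<or> A 2 \<noteq> 0"
  proof (rule ccontr)
    assume "\<not> ?thesis"
    then have "\<rho> = 0" using sum AB by simp
    then show False using tr by (simp add: trace_def)
  qed
  then show ?R
  proof
    assume "A 1 \<noteq> 0"
    from unit_vector_of_annihilated[OF this M(3) ann(3,1)] show ?R by blast
  next
    assume "A 2 \<noteq> 0"
    from unit_vector_of_annihilated[OF this M(4) ann(4,2)] show ?R by blast
  qed
next
  assume ?R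
  then obtain \<psi> j where \<psi>: "norm \<psi> = 1" and j: "j \<in> {1, 2}"
    and MN: "braket \<psi> (M j *v \<psi>) = 1" "braket \<psi> (N j *v \<psi>) = 0" by blast
  define H :: "conclusion \<Rightarrow> nat \<Rightarrow> complex ^ 'd ^ 'd" where
    "H c k = (if c = (if k = j then Concl_M else Concl_N) then outer \<psi> else 0)" for c k
  have "is_test 2 (outer \<psi>) H"
    unfolding is_test_two by (simp add: H_def pos_semidef_outer pos_semidef_zero trace_outer \<psi>)
  \<comment> \<open>Since outcome \<open>j\<close> is certain under \<open>M\<close>, the other
    outcome, which leads to \<open>Concl_N\<close>, has probability 0.\<close>
  moreover have "braket \<psi> (M 1 *v \<psi>) + braket \<psi> (M 2 *v \<psi>) = 1"
    using assms(1) \<psi>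
    by (simp add: povm_two braket_self flip: braket_add_right matrix_vector_mult_add_rdistrib)
  moreover have "trace (0 ** B) = 0" for B :: "complex ^ 'd ^ 'd"
    by (simp add: trace_def)
  ultimately show ?L
    unfolding perfectly_discriminable_iff[OF assms(1-4)] concl_prob_two using j MN
    by (intro exI[of _ "outer \<psi>"] exI[of _ H]) (auto simp: H_def trace_outer_mult)
qed

end
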